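(* Let $(N_n)$ be the Narayana's cows sequence, defined by $N_0=N_1=N_2=1$ and $N_n=N_{n-1}+N_{n-3}$ for $n\geq 3$, with the convention $N_j=0$ for $j<0$. Then for all integers $n,k\geq 1$, $$N_{n+k}=N_nN_k+N_{n-1}N_{k-2}+N_{n-2}N_{k-1}.$$ *)

theory Defs
  imports Main
begin

fun narayana_nat :: "nat \<Rightarrow> nat" where
  "narayana_nat 0 = 1"
| "narayana_nat (Suc 0) = 1"
| "narayana_nat (Suc (Suc 0)) = 1"
| "narayana_nat (Suc (Suc (Suc n))) = narayana_nat (Suc (Suc n)) + narayana_nat n"

text \<open>Indices are integers so that the sequence can vanish at negative indices; on \<open>nat\<close>, truncated
  subtraction would replace a negative index by \<open>0\<close>, where the value is \<open>1\<close>.\<close>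

definition narayana :: "int \<Rightarrow> nat" where
  "narayana j = (if j < 0 then 0 else narayana_nat (nat j))"

end

theory Submission
  imports Defs
begin

text \<open>The right-hand side depends only on \<open>n + k\<close>. Expanding \<open>N\<^bsub>n+1\<^esub> = N\<^bsub>n\<^esub> + N\<^bsub>n-2\<^esub>\<close> in it at the
  arguments \<open>(n + 1, k)\<close>, and collecting the terms in \<open>N\<^bsub>n\<^esub>\<close> with \<open>N\<^bsub>k\<^esub> + N\<^bsub>k-2\<^esub> = N\<^bsub>k+1\<^esub>\<close>, gives its value
  at \<open>(n, k + 1)\<close>. Units can therefore be moved from the second argument to the first until that
  argument is \<open>0\<close>; there the terms with a negative index vanish and only \<open>N\<^bsub>n+k\<^esub> N\<^bsub>0\<^esub>\<close> is left.\<close>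

text \<open>With the value \<open>0\<close> at negative indices, the recurrence also produces the initial values at \<open>1\<close>
  and \<open>2\<close> from the one at \<open>0\<close>. It fails only for \<open>j = -1\<close>, where the value \<open>1\<close> at \<open>0\<close> is not the
  sum of two zeros.\<close>

lemma narayana_recurrence:
  assumes "j \<noteq> -1"
  shows "narayana (j + 1) = narayana j + narayana (j - 2)"
proof -
  consider "j < -1" | "j = 0" | "j = 1" | "j \<ge> 2" using assms by linarith
  then show ?thesis
  proof cases
    case 4
    then obtain m where "j = int m + 2" by (metis zle_iff_zadd add.commute)
    moreover have "nat (3 + int m) = Suc (Suc (Suc m))" "nat (int m + 2) = Suc (Suc m)"
      by simp_all
    ultimately show ?thesis by (simp add: narayana_def)
  qed (simp_all add: narayana_def numeral_2_eq_2)
qed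

lemma narayana_add:
  assumes "k \<ge> 0" and "n \<ge> 0"
  shows "narayana (n + k) =
    narayana n * narayana k + narayana (n - 1) * narayana (k - 2) + narayana (n - 2) * narayana (k - 1)"
  using assms
proof (induction k arbitrary: n rule: int_ge_induct)
  case base
  then show ?case by (simp add: narayana_def)
next
  case (step k)
  have "narayana (n + (k + 1)) = narayana ((n + 1) + k)"
    by (simp add: algebra_simps)
  also have "\<dots> = narayana (n + 1) * narayana k + narayana n * narayana (k - 2)
      + narayana (n - 1) * narayana (k - 1)"
    using step.IH[of "n + 1"] step.prems by simp
  also have "\<dots> = narayana n * narayana (k + 1) + narayana (n - 1) * narayana (k - 1)
      + narayana (n - 2) * narayana k"
    using narayana_recurrence[of n] narayana_recurrence[of k] step.hyps step.prems
    by (simp add: algebra_simps)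
  finally show ?case by simp
qed

theorem corollary4:
  fixes n k :: int
  assumes "n \<ge> 1" and "k \<ge> 1"
  shows "narayana (n + k) =
    narayana n * narayana k + narayana (n - 1) * narayana (k - 2) + narayana (n - 2) * narayana (k - 1)"
  using assms by (intro narayana_add) simp_all

end
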